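(* Let $X$ be a simple graph with an automorphism $\tau$ which is a free involution, let $f:X\to\mathbb{Z}$ be any function on the vertex set, and assume that $|f(a)-f(b)|\le m$ whenever $a$ and $b$ are connected by an edge. Then there is some point (vertex) $x\in X$ with $|f(x)-f(\tau(x))|<2m$.
   Context: A simple graph is undirected, with no looped or multiple edges; $X$ also denotes its vertex set. A free involution is a map $\tau$ on the vertex set with $\tau(\tau(x))=x$ for all vertices $x$ and with no fixed vertex. Here $m$ is an integer.
   Formalization: The graph X is additionally assumed connected (hence nonempty) and m positive; without these the claim fails, e.g. for two isolated vertices swapped by τ with f = 0, 2 and m = 1, or for a single edge with f = 0 and m = 0. *)

theory Defs
  imports "Graph_Theory.Graph_Theory"
begin

text \<open>
  A simple graph, not necessarily finite, is a \<open>pair_bidirected_digraph\<close>: arcs are ordered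
  pairs of distinct vertices (no loops, no multiple edges), and the arc relation is symmetric.
  Functions on the vertex set are total functions whose values outside \<open>pverts X\<close> are irrelevant.
  The library's \<open>connected\<close> requires a nonempty vertex set.
\<close>

definition graph_automorphism :: "'a pair_pre_digraph \<Rightarrow> ('a \<Rightarrow> 'a) \<Rightarrow> bool" where
  "graph_automorphism X \<tau> \<longleftrightarrow>
     bij_betw \<tau> (pverts X) (pverts X) \<and>
     (\<forall>a\<in>pverts X. \<forall>b\<in>pverts X. (\<tau> a, \<tau> b) \<in> parcs X \<longleftrightarrow> (a, b) \<in> parcs X)"

definition free_involution :: "'a set \<Rightarrow> ('a \<Rightarrow> 'a) \<Rightarrow> bool" where
  "free_involution V \<tau> \<longleftrightarrow> (\<forall>x\<in>V. \<tau> x \<in> V \<and> \<tau> (\<tau> x) = x \<and> \<tau> x \<noteq> x)"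

end

theory Submission
  imports Defs
begin

text \<open>
  Consider \<open>g x = f x - f (\<tau> x)\<close>. Since \<open>\<tau>\<close> is an involution, \<open>g\<close> is odd, that is
  \<open>g (\<tau> x) = - g x\<close>, so a walk from a vertex \<open>x\<close> to \<open>\<tau> x\<close>, which exists by connectedness,
  leads from a value of \<open>g\<close> to its opposite. Since \<open>\<tau>\<close> maps edges to edges, \<open>g\<close> changes by at
  most \<open>2 * m\<close> along each edge. The discrete intermediate value theorem
  \<open>reachable_small_value\<close> then gives a vertex where \<open>\<bar>g\<bar>\<close> is at most half that step, that is
  at most \<open>m\<close>, which is less than \<open>2 * m\<close> because \<open>m\<close> is positive.
\<close>

text \<open>
  A discrete intermediate value theorem. If every value exceeded \<open>d / 2\<close> in absolute value, then
  a change of sign along an arc would be a jump by more than \<open>d\<close>; hence \<open>h\<close> would stay positive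
  on everything reachable from \<open>u\<close>.
\<close>

lemma (in wf_digraph) reachable_small_value:
  fixes h :: "'a \<Rightarrow> 'c :: linordered_idom"
  assumes reach: "u \<rightarrow>\<^sup>* v"
    and step_le: "\<And>a b. a \<rightarrow> b \<Longrightarrow> \<bar>h a - h b\<bar> \<le> d"
    and "0 \<le> d" and start: "0 \<le> h u" and finish: "h v \<le> 0"
  shows "\<exists>w. u \<rightarrow>\<^sup>* w \<and> 2 * \<bar>h w\<bar> \<le> d"
proof (rule ccontr)
  assume "\<not> ?thesis"
  then have big: "d < 2 * \<bar>h w\<bar>" if "u \<rightarrow>\<^sup>* w" for w
    using that by (meson not_le)
  have "0 \<le> h v"
    using reach
  proof (induction rule: reachable_induct)
    case base
    show ?case by (rule start)
  next
    case (step x y)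
    then have "u \<rightarrow>\<^sup>* y" by (blast intro: reachable_adj_trans)
    with step big[of x] big[of y] step_le[of x y] show ?case
      by linarith
  qed
  with finish big[OF reach] \<open>0 \<le> d\<close> show False by simp
qed

theorem corollary3p6:
  fixes X :: "'a pair_pre_digraph"
    and \<tau> :: "'a \<Rightarrow> 'a"
    and f :: "'a \<Rightarrow> int"
    and m :: int
  assumes "pair_bidirected_digraph X"
    and "connected (with_proj X)"
    and "graph_automorphism X \<tau>"
    and "free_involution (pverts X) \<tau>"
    and "m > 0"
    and "\<And>a b. (a, b) \<in> parcs X \<Longrightarrow> \<bar>f a - f b\<bar> \<le> m"
  shows "\<exists>x\<in>pverts X. \<bar>f x - f (\<tau> x)\<bar> < 2 * m"
proof -
  interpret X: pair_bidirected_digraph X by fact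
  define g where "g x = f x - f (\<tau> x)" for x
  have inv: "\<tau> x \<in> pverts X" "\<tau> (\<tau> x) = x" if "x \<in> pverts X" for x
    using assms(4) that by (auto simp: free_involution_def)
  have odd: "g (\<tau> x) = - g x" if "x \<in> pverts X" for x
    using inv that by (simp add: g_def)
  have step: "\<bar>g a - g b\<bar> \<le> 2 * m" if "(a, b) \<in> parcs X" for a b
  proof -
    have "(\<tau> a, \<tau> b) \<in> parcs X"
      using assms(3) that X.in_arcsD1 X.in_arcsD2 by (auto simp: graph_automorphism_def)
    from assms(6)[OF this] assms(6)[OF that] show ?thesis
      by (simp add: g_def)
  qed
  have conn: "strongly_connected (with_proj X)"
    using X.symmetric_connected_imp_strongly_connected X.sym_arcs assms(2) by blast
  then obtain x where "x \<in> pverts X"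
    by (auto simp: strongly_connected_def)
  \<comment> \<open>By oddness, \<open>g\<close> is nonnegative at one of \<open>x\<close> and \<open>\<tau> x\<close>; a walk is started there.\<close>
  then obtain u where u: "u \<in> pverts X" "0 \<le> g u"
    using inv odd by (metis linear neg_0_le_iff_le)
  have "u \<rightarrow>\<^sup>*\<^bsub>with_proj X\<^esub> \<tau> u"
    using conn u inv by (simp add: strongly_connected_def)
  then obtain w where w: "u \<rightarrow>\<^sup>*\<^bsub>with_proj X\<^esub> w" "2 * \<bar>g w\<bar> \<le> 2 * m"
    using X.reachable_small_value[of u "\<tau> u" g "2 * m"] step u odd \<open>m > 0\<close> by auto
  then have "w \<in> pverts X"
    using X.reachable_in_verts by blast
  moreover have "\<bar>f w - f (\<tau> w)\<bar> < 2 * m"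
    using w(2) \<open>m > 0\<close> by (simp add: g_def)
  ultimately show ?thesis by blast
qed

end
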